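(* Let $S_O$ be a finite knowledge base with core $\mathrm{Atom}(S_O)$, let $Q=\{q_1,\dots,q_K\}\subseteq\mathrm{Cn}(\mathrm{Atom}(S_O))$ be a finite query set with probabilities $p_i>0$, and let $\mathcal U\subseteq\mathrm{Cn}(\mathrm{Atom}(S_O))\setminus S_O$ be a candidate cache set. For $S\subseteq\mathcal U$ let $n_i(S):=\mathrm{Dd}(q_i\mid S_O\cup S)$ and $$\Delta(S):=\sum_{i=1}^Kp_i\,[n_i(\varnothing)-n_i(S)].$$ Assume that for each $q_i$ and each $u\in\mathcal U$ the depth reduction exhibits diminishing returns: for all $X\subseteq Y\subseteq\mathcal U$ and $u\in\mathcal U\setminus Y$, $$n_i(X)-n_i(X\cup\{u\})\ge n_i(Y)-n_i(Y\cup\{u\}).$$ Then $\Delta$ is normalized ($\Delta(\varnothing)=0$), monotone, and submodular on $2^{\mathcal U}$.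
   Context: Formulas are taken from an ambient set $\mathbb S_O$ of formulas of a fixed logic with an effective proof system; $\mathrm{Cn}(\Gamma)$ is the deductive closure of a finite set $\Gamma$. $\mathrm{Atom}(S_O)$ is the output of: start with $A=S_O$; scan $s\in S_O$ in a fixed canonical order, and whenever $s\in\mathrm{Cn}(A\setminus\{s\})$ remove $s$ from $A$. Depth: $P_O$ assigns to each $s\in\mathbb S_O$ a finite set $P_O(s)\subseteq\mathbb S_O$, computable from the encoding of $s$, and backward unfolding along $P_O$ has no infinite chain; for $s$ outside the premise base, $P_O(s)$ is the set of immediate premises in a fixed normal-form single-step inference concluding $s$. For a finite $B\subseteq\mathbb S_O$: $\mathrm{Dd}(s\mid B)=0$ if $s\in B$, else $1+\max_{s'\in P_O(s)}\mathrm{Dd}(s'\mid B)$ (with $\max\varnothing=0$). *)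

theory Defs
  imports Complex_Main "HOL-Library.Nat_Bijection"
begin

(* General recursive functions, as (arity, function on argument lists). Only total functions
   arise, because minimisation is applied to regular functions; the value on a list whose
   length differs from the arity carries no meaning. *)
inductive recursive :: "nat \<Rightarrow> (nat list \<Rightarrow> nat) \<Rightarrow> bool" where
  zero: "recursive n (\<lambda>xs. 0)"
| succ: "recursive 1 (\<lambda>xs. Suc (hd xs))"
| proj: "i < n \<Longrightarrow> recursive n (\<lambda>xs. xs ! i)"
| comp: "recursive (length fs) g \<Longrightarrow> (\<And>f. f \<in> set fs \<Longrightarrow> recursive n f) \<Longrightarrow>
    recursive n (\<lambda>xs. g (map (\<lambda>f. f xs) fs))"
| prec: "recursive n f \<Longrightarrow> recursive (n + 2) g \<Longrightarrow>
    recursive (Suc n) (\<lambda>xs. rec_nat (f (tl xs)) (\<lambda>y r. g (y # r # tl xs)) (hd xs))"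
| mu: "recursive (Suc n) f \<Longrightarrow> (\<And>xs. length xs = n \<Longrightarrow> \<exists>y. f (y # xs) = 0) \<Longrightarrow>
    recursive n (\<lambda>xs. LEAST y. f (y # xs) = 0)"

definition computable :: "(nat \<Rightarrow> nat) \<Rightarrow> bool" where
  "computable h \<longleftrightarrow> (\<exists>g. recursive 1 g \<and> (\<forall>x. g [x] = h x))"

definition decidable :: "nat set \<Rightarrow> bool" where
  "decidable A \<longleftrightarrow> computable (\<lambda>x. if x \<in> A then 1 else 0)"

(* An element (ps, s) of rules is a single-step inference with premises ps and conclusion s;
   axioms are the inferences with ps = []. *)
locale proof_system =
  fixes Fm :: "'f set"
    and enc :: "'f \<Rightarrow> nat"
    and rules :: "('f list \<times> 'f) set"
  assumes enc_inj: "inj_on enc Fm"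
    and rules_Fm: "rules \<subseteq> lists Fm \<times> Fm"
    and Fm_decidable: "decidable (enc ` Fm)"
    and rules_decidable:
      "decidable ((\<lambda>(ps, s). prod_encode (list_encode (map enc ps), enc s)) ` rules)"

inductive_set Cn :: "('f list \<times> 'f) set \<Rightarrow> 'f set \<Rightarrow> 'f set"
  for rules :: "('f list \<times> 'f) set" and \<Gamma> :: "'f set" where
  base: "s \<in> \<Gamma> \<Longrightarrow> s \<in> Cn rules \<Gamma>"
| step: "(ps, s) \<in> rules \<Longrightarrow> (\<And>t. t \<in> set ps \<Longrightarrow> t \<in> Cn rules \<Gamma>) \<Longrightarrow> s \<in> Cn rules \<Gamma>"

(* The order of the type is the canonical scanning order. *)
definition Atom :: "('f::linorder list \<times> 'f) set \<Rightarrow> 'f set \<Rightarrow> 'f set" where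
  "Atom rules S =
    foldl (\<lambda>A s. if s \<in> Cn rules (A - {s}) then A - {s} else A) S (sorted_list_of_set S)"

(* The inference condition is imposed only on formulas that are derivable from the base: a
   formula that is not derivable cannot have a well-founded unfolding into inferences. *)
locale premise_map = proof_system Fm enc rules
  for Fm :: "'f set" and enc :: "'f \<Rightarrow> nat" and rules :: "('f list \<times> 'f) set" +
  fixes P :: "'f \<Rightarrow> 'f set"
    and S :: "'f set"
  assumes P_finite: "s \<in> Fm \<Longrightarrow> finite (P s)"
    and P_Fm: "s \<in> Fm \<Longrightarrow> P s \<subseteq> Fm"
    and P_computable: "\<exists>h. computable h \<and> (\<forall>s\<in>Fm. h (enc s) = set_encode (enc ` P s))"
    and P_wf: "wf {(s', s). s \<in> Fm \<and> s' \<in> P s}"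
    and P_inference: "s \<in> Cn rules S - S \<Longrightarrow> \<exists>ps. (ps, s) \<in> rules \<and> P s = set ps"

(* Inserting 0 implements max {} = 0. The recursion equation is Dd_rec below. *)
definition Dd :: "'f set \<Rightarrow> ('f \<Rightarrow> 'f set) \<Rightarrow> 'f \<Rightarrow> 'f set \<Rightarrow> nat" where
  "Dd Fm P s B = wfrec {(s', s). s \<in> Fm \<and> s' \<in> P s}
    (\<lambda>d s. if s \<in> B then 0 else 1 + Max (insert 0 (d ` P s))) s"

lemma (in premise_map) Dd_rec:
  assumes "s \<in> Fm"
  shows "Dd Fm P s B = (if s \<in> B then 0 else 1 + Max (insert 0 ((\<lambda>s'. Dd Fm P s' B) ` P s)))"
proof -
  let ?R = "{(s', s). s \<in> Fm \<and> s' \<in> P s}"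
  have "cut (\<lambda>s'. Dd Fm P s' B) ?R s ` P s = (\<lambda>s'. Dd Fm P s' B) ` P s"
    using assms by (intro image_cong) (auto simp: cut_def)
  then show ?thesis
    unfolding Dd_def by (subst wfrec[OF P_wf]) simp
qed

definition Delta ::
  "'f set \<Rightarrow> ('f \<Rightarrow> 'f set) \<Rightarrow> 'f set \<Rightarrow> nat \<Rightarrow> (nat \<Rightarrow> 'f) \<Rightarrow> (nat \<Rightarrow> real) \<Rightarrow> 'f set \<Rightarrow> real" where
  "Delta Fm P S\<^sub>O K q p S =
    (\<Sum>i = 1..K. p i * (real (Dd Fm P (q i) (S\<^sub>O \<union> {})) - real (Dd Fm P (q i) (S\<^sub>O \<union> S))))"

definition submodular_on :: "'a set \<Rightarrow> ('a set \<Rightarrow> real) \<Rightarrow> bool" where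
  "submodular_on U f \<longleftrightarrow> (\<forall>X Y. X \<subseteq> U \<longrightarrow> Y \<subseteq> U \<longrightarrow> f (X \<union> Y) + f (X \<inter> Y) \<le> f X + f Y)"

end

theory Submission
  imports Defs
begin

text \<open>Diminishing returns for single elements yield submodularity only by adding elements one at a
  time, and the candidate set may be infinite. But backward unfolding is well-founded and finitely
  branching, so (Koenig) each depth depends on the base only through a finite set of formulas, and
  adding finitely many elements suffices. Monotonicity is the antitonicity of depth in the base.\<close>

text \<open>Telescoping over \<open>A\<close>: the single-element inequality is applied between
  \<open>X \<union> A\<close> and \<open>Y \<union> A\<close> at each stage. Disjointness of
  \<open>A\<close> from \<open>Y\<close> keeps every new element outside the larger set, as
  \<open>step\<close> demands.\<close>

lemma diminishing_returns_finite:
  fixes f :: "'a set \<Rightarrow> real"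
  assumes step: "\<And>X Y u. X \<subseteq> Y \<Longrightarrow> Y \<subseteq> U \<Longrightarrow> u \<in> U - Y \<Longrightarrow>
      f (insert u Y) - f Y \<le> f (insert u X) - f X"
    and "finite A" "X \<subseteq> Y" "Y \<union> A \<subseteq> U" "A \<inter> Y = {}"
  shows "f (Y \<union> A) - f Y \<le> f (X \<union> A) - f X"
  using assms(2,4,5)
proof (induction A)
  case empty
  then show ?case by simp
next
  case (insert a A)
  have "f (insert a (Y \<union> A)) - f (Y \<union> A) \<le> f (insert a (X \<union> A)) - f (X \<union> A)"
    using insert.prems insert.hyps \<open>X \<subseteq> Y\<close> by (intro step) auto
  moreover have "f (Y \<union> A) - f Y \<le> f (X \<union> A) - f X"
    using insert.prems by (intro insert.IH) auto
  ultimately show ?case by simp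
qed

lemma submodular_on_if_diminishing_returns:
  fixes f :: "'a set \<Rightarrow> real"
  assumes step: "\<And>X Y u. X \<subseteq> Y \<Longrightarrow> Y \<subseteq> U \<Longrightarrow> u \<in> U - Y \<Longrightarrow>
      f (insert u Y) - f Y \<le> f (insert u X) - f X"
    and "finite D" and local: "\<And>X. f X = f (X \<inter> D)"
  shows "submodular_on U f"
  unfolding submodular_on_def
proof (intro allI impI)
  fix X Y assume XY: "X \<subseteq> U" "Y \<subseteq> U"
  \<comment> \<open>Passing from \<open>Y\<close> to \<open>X \<union> Y\<close>, and from
    \<open>X \<inter> Y\<close> to \<open>X\<close>, adds \<open>X - Y\<close>, which may be
    infinite. Its trace on \<open>D\<close> is finite and gives the same values of
    \<open>f\<close>.\<close>
  define A where "A = (X - Y) \<inter> D"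
  have "f (Y \<union> A) - f Y \<le> f (X \<inter> Y \<union> A) - f (X \<inter> Y)"
    using XY \<open>finite D\<close> by (intro diminishing_returns_finite[OF step]) (auto simp: A_def)
  moreover have "f (Y \<union> A) = f (X \<union> Y)"
  proof -
    have "(Y \<union> A) \<inter> D = (X \<union> Y) \<inter> D" by (auto simp: A_def)
    then show ?thesis by (metis local)
  qed
  moreover have "f (X \<inter> Y \<union> A) = f X"
  proof -
    have "(X \<inter> Y \<union> A) \<inter> D = X \<inter> D" by (auto simp: A_def)
    then show ?thesis by (metis local)
  qed
  ultimately show "f (X \<union> Y) + f (X \<inter> Y) \<le> f X + f Y" by linarith
qed

lemma submodular_on_weighted_sum:
  assumes "\<And>i. i \<in> I \<Longrightarrow> 0 \<le> p i" and "\<And>i. i \<in> I \<Longrightarrow> submodular_on U (f i)"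
  shows "submodular_on U (\<lambda>X. \<Sum>i\<in>I. p i * f i X)"
  unfolding submodular_on_def
proof (intro allI impI)
  fix X Y assume "X \<subseteq> U" "Y \<subseteq> U"
  then have "p i * (f i (X \<union> Y) + f i (X \<inter> Y)) \<le> p i * (f i X + f i Y)" if "i \<in> I" for i
    using assms that by (intro mult_left_mono) (auto simp: submodular_on_def)
  then have "(\<Sum>i\<in>I. p i * (f i (X \<union> Y) + f i (X \<inter> Y))) \<le> (\<Sum>i\<in>I. p i * (f i X + f i Y))"
    by (rule sum_mono)
  then show "(\<Sum>i\<in>I. p i * f i (X \<union> Y)) + (\<Sum>i\<in>I. p i * f i (X \<inter> Y))
      \<le> (\<Sum>i\<in>I. p i * f i X) + (\<Sum>i\<in>I. p i * f i Y)"
    by (simp add: distrib_left sum.distrib)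
qed

lemma Atom_subset:
  assumes "finite S"
  shows "Atom rules S \<subseteq> S"
proof -
  \<comment> \<open>The start value \<open>B\<close> is arbitrary because the accumulator may lose
    an element at each step of the scan.\<close>
  have "foldl (\<lambda>A s. if s \<in> Cn rules (A - {s}) then A - {s} else A) B xs \<subseteq> B" for B xs
  proof (induction xs arbitrary: B)
    case Nil
    then show ?case by simp
  next
    case (Cons x xs)
    show ?case
      using Cons.IH[of "B - {x}"] Cons.IH[of B] by auto
  qed
  then show ?thesis by (simp add: Atom_def)
qed

lemma (in proof_system) Cn_subset_Fm:
  assumes "\<Gamma> \<subseteq> Fm"
  shows "Cn rules \<Gamma> \<subseteq> Fm"
proof
  fix s assume "s \<in> Cn rules \<Gamma>"
  then show "s \<in> Fm" by cases (use assms rules_Fm in auto)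
qed

context premise_map
begin

text \<open>Enlarging the base only turns more nodes of the unfolding into leaves of depth 0, and
  the maximum is monotone in its arguments.\<close>

lemma Dd_antimono:
  assumes "s \<in> Fm" "B \<subseteq> C"
  shows "Dd Fm P s C \<le> Dd Fm P s B"
  using assms(1)
proof (induction s rule: wf_induct_rule[OF P_wf])
  case (1 s)
  have "Dd Fm P s' C \<le> Max (insert 0 ((\<lambda>s'. Dd Fm P s' B) ` P s))" if "s' \<in> P s" for s'
  proof -
    have "Dd Fm P s' C \<le> Dd Fm P s' B"
      using 1 that P_Fm by auto
    also have "\<dots> \<le> Max (insert 0 ((\<lambda>s'. Dd Fm P s' B) ` P s))"
      using that P_finite[OF 1(2)] by (intro Max_ge) auto
    finally show ?thesis .
  qed
  then have "Max (insert 0 ((\<lambda>s'. Dd Fm P s' C) ` P s))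
      \<le> Max (insert 0 ((\<lambda>s'. Dd Fm P s' B) ` P s))"
    using P_finite[OF 1(2)] by (intro Max.boundedI) auto
  \<comment> \<open>If \<open>s\<close> is in \<open>C\<close>, the left side is 0; otherwise
    \<open>s\<close> is in neither base and both sides unfold.\<close>
  then show ?case
    using assms(2) by (auto simp: Dd_rec[OF 1(2)])
qed

lemma Dd_finitely_determined:
  assumes "s \<in> Fm"
  shows "\<exists>D. finite D \<and> (\<forall>B. Dd Fm P s B = Dd Fm P s (B \<inter> D))"
  using assms
proof (induction s rule: wf_induct_rule[OF P_wf])
  case (1 s)
  have "\<forall>s'\<in>P s. \<exists>D. finite D \<and> (\<forall>B. Dd Fm P s' B = Dd Fm P s' (B \<inter> D))"
    using 1 P_Fm by blast
  then obtain D where D: "\<And>s'. s' \<in> P s \<Longrightarrow> finite (D s')"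
    "\<And>s' B. s' \<in> P s \<Longrightarrow> Dd Fm P s' B = Dd Fm P s' (B \<inter> D s')"
    by metis
  \<comment> \<open>The recursion at \<open>s\<close> tests membership of \<open>s\<close> itself
    and then consults only the finitely many premises, so their determining sets together with
    \<open>s\<close> suffice.\<close>
  define E where "E = insert s (\<Union>s'\<in>P s. D s')"
  have "finite E"
    using D(1) P_finite[OF 1(2)] by (simp add: E_def)
  moreover have "Dd Fm P s B = Dd Fm P s (B \<inter> E)" for B
  proof -
    have "Dd Fm P s' B = Dd Fm P s' (B \<inter> E)" if "s' \<in> P s" for s'
    proof -
      \<comment> \<open>\<open>B\<close> and \<open>B \<inter> E\<close> have the same trace on
        \<open>D s'\<close>, so the induction hypothesis, used for both, equates the depths.\<close>
      have "B \<inter> E \<inter> D s' = B \<inter> D s'" using that by (auto simp: E_def)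
      then show ?thesis by (metis D(2) that)
    qed
    then have "(\<lambda>s'. Dd Fm P s' B) ` P s = (\<lambda>s'. Dd Fm P s' (B \<inter> E)) ` P s"
      by (intro image_cong) auto
    then show ?thesis
      by (simp add: Dd_rec[OF 1(2)] E_def)
  qed
  ultimately show ?case by blast
qed

end

theorem mainTheorem8:
  fixes Fm :: "'f::linorder set"
    and enc :: "'f \<Rightarrow> nat"
    and rules :: "('f list \<times> 'f) set"
    and P :: "'f \<Rightarrow> 'f set"
    and S\<^sub>O U :: "'f set"
    and K :: nat
    and q :: "nat \<Rightarrow> 'f"
    and p :: "nat \<Rightarrow> real"
  assumes "proof_system Fm enc rules"
    and "finite S\<^sub>O" and "S\<^sub>O \<subseteq> Fm"
    and "premise_map Fm enc rules P S\<^sub>O"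
    and "q ` {1..K} \<subseteq> Cn rules (Atom rules S\<^sub>O)"
    and "\<forall>i\<in>{1..K}. p i > 0"
    and "U \<subseteq> Cn rules (Atom rules S\<^sub>O) - S\<^sub>O"
    and "\<forall>i\<in>{1..K}. \<forall>X Y u. X \<subseteq> Y \<longrightarrow> Y \<subseteq> U \<longrightarrow> u \<in> U - Y \<longrightarrow>
      real (Dd Fm P (q i) (S\<^sub>O \<union> X)) - real (Dd Fm P (q i) (S\<^sub>O \<union> (X \<union> {u})))
        \<ge> real (Dd Fm P (q i) (S\<^sub>O \<union> Y)) - real (Dd Fm P (q i) (S\<^sub>O \<union> (Y \<union> {u})))"
  shows "Delta Fm P S\<^sub>O K q p {} = 0
    \<and> mono_on (Pow U) (Delta Fm P S\<^sub>O K q p)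
    \<and> submodular_on U (Delta Fm P S\<^sub>O K q p)"
proof -
  interpret premise_map Fm enc rules P S\<^sub>O by fact
  define n where "n i X = real (Dd Fm P (q i) (S\<^sub>O \<union> X))" for i X
  have Delta: "Delta Fm P S\<^sub>O K q p = (\<lambda>X. \<Sum>i = 1..K. p i * (n i {} - n i X))"
    by (simp add: Delta_def n_def fun_eq_iff)
  \<comment> \<open>The depth recursion is available only on \<open>Fm\<close>. Queries lie there
    because the core is part of the base and rules conclude formulas.\<close>
  have q: "q i \<in> Fm" if "i \<in> {1..K}" for i
    using that assms(2,3,5) Cn_subset_Fm[of "Atom rules S\<^sub>O"] Atom_subset[of S\<^sub>O rules] by blast
  have "mono_on (Pow U) (Delta Fm P S\<^sub>O K q p)"
  proof (rule mono_onI)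
    fix X Y :: "'f set" assume "X \<subseteq> Y"
    then have "n i Y \<le> n i X" if "i \<in> {1..K}" for i
      using Dd_antimono[OF q[OF that], of "S\<^sub>O \<union> X" "S\<^sub>O \<union> Y"] by (auto simp: n_def)
    then show "Delta Fm P S\<^sub>O K q p X \<le> Delta Fm P S\<^sub>O K q p Y"
      unfolding Delta using assms(6) by (intro sum_mono mult_left_mono) (auto simp: less_imp_le)
  qed
  moreover have "submodular_on U (Delta Fm P S\<^sub>O K q p)"
    unfolding Delta
  proof (rule submodular_on_weighted_sum)
    fix i assume i: "i \<in> {1..K}"
    then show "0 \<le> p i" using assms(6) by (simp add: less_imp_le)
    obtain D where "finite D" and D: "\<And>B. Dd Fm P (q i) B = Dd Fm P (q i) (B \<inter> D)"
      using Dd_finitely_determined[OF q[OF i]] by blast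
    show "submodular_on U (\<lambda>X. n i {} - n i X)"
    proof (rule submodular_on_if_diminishing_returns[OF _ \<open>finite D\<close>])
      fix X Y u assume "X \<subseteq> Y" "Y \<subseteq> U" "u \<in> U - Y"
      then have "n i Y - n i (Y \<union> {u}) \<le> n i X - n i (X \<union> {u})"
        unfolding n_def using assms(8) i by blast
      \<comment> \<open>The constant \<open>n i {}\<close> cancels, so the marginal gains are
        exactly the depth reductions of the hypothesis.\<close>
      then show "(n i {} - n i (insert u Y)) - (n i {} - n i Y)
          \<le> (n i {} - n i (insert u X)) - (n i {} - n i X)"
        by simp
    next
      fix X
      \<comment> \<open>\<open>D\<close> determines the depth through the whole base, so
        \<open>S\<^sub>O\<close> has to be carried along: both bases have the same trace on
        \<open>D\<close>.\<close>
      have "(S\<^sub>O \<union> (X \<inter> D)) \<inter> D = (S\<^sub>O \<union> X) \<inter> D" by blast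
      then show "n i {} - n i X = n i {} - n i (X \<inter> D)"
        by (metis D n_def)
    qed
  qed
  ultimately show ?thesis by (simp add: Delta)
qed

end
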